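(* Let $q$ be a prime power and let $n\geq 2$ be an integer. The number of distance vectors in $\mathcal{D}(n)$ corresponding to pairs of disjoint flags, that is, the cardinality of $\{\mathbf{d}(\mathcal{F},\mathcal{F}')\mid \mathcal{F},\mathcal{F}'\in\mathcal{F}_q(n) \text{ disjoint}\}$, is $E_n=M_{n-2}$, where $M_m$ denotes the $m$-th Motzkin number.
   Context: Let $\mathbb{F}_q$ be the finite field with $q$ elements. A full flag on $\mathbb{F}_q^n$ is a sequence $\mathcal{F}=(\mathcal{F}_1,\dots,\mathcal{F}_{n-1})$ of $\mathbb{F}_q$-subspaces of $\mathbb{F}_q^n$ with $\mathcal{F}_1\subsetneq\cdots\subsetneq\mathcal{F}_{n-1}$ and $\dim \mathcal{F}_i=i$ for every $i$; the set of all full flags is the full flag variety $\mathcal{F}_q(n)$. For subspaces $\mathcal{U},\mathcal{V}$ of the same dimension $k$, the injection distance is $d_I(\mathcal{U},\mathcal{V})=k-\dim(\mathcal{U}\cap\mathcal{V})$. The distance vector of $\mathcal{F},\mathcal{F}'\in\mathcal{F}_q(n)$ is $\mathbf{d}(\mathcal{F},\mathcal{F}')=(d_I(\mathcal{F}_1,\mathcal{F}'_1),\dots,d_I(\mathcal{F}_{n-1},\mathcal{F}'_{n-1}))\in\mathbb{Z}^{n-1}$, and $\mathcal{D}(n)=\{\mathbf{d}(\mathcal{F},\mathcal{F}') \mid \mathcal{F},\mathcal{F}'\in\mathcal{F}_q(n)\}$. Two different full flags $\mathcal{F},\mathcal{F}'$ are disjoint if $\mathcal{F}_i\neq\mathcal{F}'_i$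 for every $1\leq i\leq n-1$. The Motzkin numbers are given by $M_0=1$ and $M_n=M_{n-1}+\sum_{k=0}^{n-2}M_kM_{n-k-2}$ for $n\geq 1$ (the sum being empty for $n=1$); $M_n$ is the number of lattice paths from $(0,0)$ to $(n,0)$ with steps $(1,1)$, $(1,-1)$, $(1,0)$ that never run below the $x$-axis. The numbers $E_n$ are defined by $E_0=E_1=0$ and $E_n=M_{n-2}$ for $n\geq 2$; for $n\geq 2$, $E_n$ is the number of such paths of length $n$ touching the $x$-axis only at $(0,0)$ and $(n,0)$. *)

theory Defs
  imports "HOL-Analysis.Cartesian_Space" "HOL-Number_Theory.Prime_Powers"
begin

text \<open>
  The space \<open>\<bbbF>\<^sub>q\<^sup>n\<close> is the type \<open>'a ^ 'n\<close> over a finite field type \<open>'a\<close>, with \<open>q = CARD('a)\<close>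
  and \<open>n = CARD('n)\<close>. Subspaces and dimensions are those of the vector space over \<open>'a\<close>
  with scalar multiplication \<open>(*s)\<close>. A flag is the list of its members; list positions start at 0,
  so the member of dimension \<open>i\<close> is at position \<open>i - 1\<close>.
\<close>

definition full_flag :: "('a::field ^ 'n) set list \<Rightarrow> bool" where
  "full_flag F \<longleftrightarrow>
     length F = CARD('n) - 1 \<and>
     sorted_wrt (\<subset>) F \<and>
     (\<forall>i<length F. vec.subspace (F ! i) \<and> vec.dim (F ! i) = i + 1)"

text \<open>The injection distance is only meaningful for subspaces of equal dimension.\<close>

definition injection_distance :: "('a::field ^ 'n) set \<Rightarrow> ('a ^ 'n) set \<Rightarrow> int" where
  "injection_distance U V = int (vec.dim U) - int (vec.dim (U \<inter> V))"

definition distance_vector :: "('a::field ^ 'n) set list \<Rightarrow> ('a ^ 'n) set list \<Rightarrow> int list" where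
  "distance_vector F F' = map2 injection_distance F F'"

definition disjoint_flags :: "('a::field ^ 'n) set list \<Rightarrow> ('a ^ 'n) set list \<Rightarrow> bool" where
  "disjoint_flags F F' \<longleftrightarrow> F \<noteq> F' \<and> (\<forall>i<CARD('n) - 1. F ! i \<noteq> F' ! i)"

text \<open>With \<open>n = Suc m\<close>, the sum over \<open>0 \<le> k \<le> n - 2\<close> ranges over \<open>k < m\<close>, and is empty for \<open>n = 1\<close>.\<close>

fun motzkin :: "nat \<Rightarrow> nat" where
  "motzkin 0 = 1"
| "motzkin (Suc m) = motzkin m + (\<Sum>k<m. motzkin k * motzkin (m - 1 - k))"

definition elevated_motzkin :: "nat \<Rightarrow> nat" where
  "elevated_motzkin n = (if n < 2 then 0 else motzkin (n - 2))"

end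

theory Submission
  imports Defs
begin

text \<open>
  Framed by zeros, the distance vector of a pair of flags has nonnegative entries and steps in
  \<open>{-1, 0, 1}\<close>, because the dimension of the intersection grows by 0, 1 or 2 from one member to the
  next; disjointness makes all entries positive. Lowering the entries by 1 leaves a Motzkin path of
  length \<open>n - 2\<close>. Conversely, every such path is realised by two coordinate flags: an up step adds two
  different fresh coordinates to the two flags, a level step adds the same fresh coordinate to both,
  and a down step gives each flag a coordinate that so far only the other one has. Paths are counted
  by the first return to the axis.
\<close>

section \<open>Motzkin paths\<close>

abbreviation small_step :: "int \<Rightarrow> int \<Rightarrow> bool" where
  "small_step x y \<equiv> \<bar>x - y\<bar> \<le> 1"

text \<open>A path of length \<open>m\<close> is given by its \<open>m + 1\<close> successive heights.\<close>

definition motzkin_paths :: "nat \<Rightarrow> int list set" where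
  "motzkin_paths m = {h. length h = Suc m \<and> hd h = 0 \<and> last h = 0 \<and>
     (\<forall>x\<in>set h. 0 \<le> x) \<and> successively small_step h}"

text \<open>Encodes an up step, the path \<open>a\<close> raised by 1, a down step, then
  \<open>b\<close>. The two steps stay implicit, as the jumps from 0 to 1 before the raised copy and
  from 1 to 0 after it. The length \<open>k\<close> of \<open>a\<close> is carried along so that the
  domain is a \<open>SIGMA\<close> set whose size is the sum in the Motzkin recursion.\<close>

definition first_return :: "nat \<times> int list \<times> int list \<Rightarrow> int list" where
  "first_return = (\<lambda>(k, a, b). 0 # map ((+) 1) a @ b)"

lemma motzkin_paths_0: "motzkin_paths 0 = {[0]}"
  by (auto simp: motzkin_paths_def length_Suc_conv)

text \<open>Removing a level first step leaves a path that still starts at 0; this accounts for the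
  summand \<open>motzkin m\<close> of the recursion.\<close>

lemma Cons_0_motzkin_paths:
  "0 # t \<in> motzkin_paths (Suc m) \<and> hd t = 0 \<longleftrightarrow> t \<in> motzkin_paths m"
  by (cases t) (auto simp: motzkin_paths_def)

lemma first_return_motzkin_paths:
  assumes "k < m" "a \<in> motzkin_paths k" "b \<in> motzkin_paths (m - 1 - k)"
  shows "first_return (k, a, b) \<in> motzkin_paths (Suc m)"
proof -
  have "a \<noteq> []" "b \<noteq> []"
    using assms by (auto simp: motzkin_paths_def)
  then show ?thesis
    using assms
    by (auto simp: motzkin_paths_def first_return_def successively_Cons successively_append_iff
        successively_map hd_append hd_map last_map)
qed

text \<open>All raised heights are positive and \<open>b\<close> begins with 0, so cutting at the
  first zero separates the two pieces.\<close>

lemma takeWhile_dropWhile_first_return: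
  assumes "a \<in> motzkin_paths k" "b \<in> motzkin_paths l"
  shows "takeWhile ((<) 0) (map ((+) 1) a @ b) = map ((+) 1) a"
    and "dropWhile ((<) 0) (map ((+) 1) a @ b) = b"
proof -
  obtain b' where b: "b = 0 # b'"
    using assms(2) by (cases b) (auto simp: motzkin_paths_def)
  have "\<forall>x\<in>set (map ((+) 1) a). 0 < x"
    using assms(1) by (auto simp: motzkin_paths_def add_pos_nonneg)
  then show "takeWhile ((<) 0) (map ((+) 1) a @ b) = map ((+) 1) a"
    and "dropWhile ((<) 0) (map ((+) 1) a @ b) = b"
    unfolding b by (subst takeWhile_append2 dropWhile_append2; fastforce)+
qed

lemma inj_on_first_return:
  "inj_on first_return (SIGMA k:K. motzkin_paths k \<times> motzkin_paths (f k))"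
proof (rule inj_onI)
  fix u v
  assume u: "u \<in> (SIGMA k:K. motzkin_paths k \<times> motzkin_paths (f k))"
    and v: "v \<in> (SIGMA k:K. motzkin_paths k \<times> motzkin_paths (f k))"
    and eq: "first_return u = first_return v"
  obtain k a b where u': "u = (k, a, b)" "a \<in> motzkin_paths k" "b \<in> motzkin_paths (f k)"
    using u by auto
  obtain l c d where v': "v = (l, c, d)" "c \<in> motzkin_paths l" "d \<in> motzkin_paths (f l)"
    using v by auto
  have app: "map ((+) 1) a @ b = map ((+) 1) c @ d"
    using eq u' v' by (simp add: first_return_def)
  have "map ((+) 1) a = map ((+) 1) c" and "b = d"
    using takeWhile_dropWhile_first_return[OF u'(2,3)] takeWhile_dropWhile_first_return[OF v'(2,3)]
      app by metis+
  moreover from this have "a = c"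
    by (simp add: inj_map_eq_map)
  moreover have "k = l"
    using u'(2) v'(2) \<open>a = c\<close> by (auto simp: motzkin_paths_def)
  ultimately show "u = v"
    using u' v' by simp
qed

text \<open>Cut \<open>t\<close> before its first zero: the part \<open>p\<close> before the cut,
  lowered by 1, and the part \<open>b\<close> from the cut on are the two required paths.\<close>

lemma motzkin_paths_first_return:
  assumes h: "0 # t \<in> motzkin_paths (Suc m)" and "hd t \<noteq> 0"
  shows "0 # t \<in> first_return ` (SIGMA k:{..<m}. motzkin_paths k \<times> motzkin_paths (m - 1 - k))"
proof -
  define p where "p = takeWhile ((<) 0) t"
  define b where "b = dropWhile ((<) 0) t"
  have t: "t = p @ b"
    by (simp add: p_def b_def)
  \<comment> \<open>The height after 0 is at most 1, nonnegative and by assumption nonzero, hence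
    1.\<close>
  have len: "length t = Suc m" and last_t: "last t = 0" and nonneg: "\<forall>x\<in>set t. 0 \<le> x"
    and step: "successively small_step t" and hd_t: "hd t = 1"
    using h \<open>hd t \<noteq> 0\<close> by (cases t; force simp: motzkin_paths_def)+
  have "t \<noteq> []"
    using len by auto
  then have "b \<noteq> []"
    using last_t last_in_set[of t] by (force simp: b_def dropWhile_eq_Nil_conv)
  have "p \<noteq> []"
    using hd_t \<open>t \<noteq> []\<close> by (cases t) (auto simp: p_def)
  have hd_b: "hd b = 0"
  proof -
    have "\<not> 0 < hd b"
      using \<open>b \<noteq> []\<close> hd_dropWhile unfolding b_def by blast
    moreover have "hd b \<in> set t"
      using \<open>b \<noteq> []\<close> by (simp add: t)
    ultimately show ?thesis
      using nonneg by force
  qed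
  have pos: "\<forall>x\<in>set p. 0 < x"
    by (auto simp: p_def dest: set_takeWhileD)
  have steps: "successively small_step p" "successively small_step b" "small_step (last p) (hd b)"
    using step \<open>p \<noteq> []\<close> \<open>b \<noteq> []\<close> unfolding t successively_append_iff by auto
  \<comment> \<open>The last height of \<open>p\<close> is positive and one small step away from
    0.\<close>
  have last_p: "last p = 1"
    using steps(3) hd_b pos last_in_set[OF \<open>p \<noteq> []\<close>] by force
  define a where "a = map (\<lambda>x. x - 1) p"
  define k where "k = length p - 1"
  have lens: "length p = Suc k" "length b = Suc (m - 1 - k)" "k < m"
    using len \<open>p \<noteq> []\<close> \<open>b \<noteq> []\<close> unfolding t k_def by (cases p; cases b; simp)+
  have "a \<in> motzkin_paths k"
    using \<open>p \<noteq> []\<close> lens pos steps last_p hd_t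
    by (auto simp: motzkin_paths_def a_def successively_map hd_map last_map t)
  moreover have "b \<in> motzkin_paths (m - 1 - k)"
    using \<open>b \<noteq> []\<close> lens steps last_t hd_b nonneg by (auto simp: motzkin_paths_def t)
  moreover have "0 # t = first_return (k, a, b)"
    by (simp add: first_return_def a_def t o_def)
  ultimately show ?thesis
    using lens by (intro image_eqI[where x = "(k, a, b)"]) auto
qed

lemma motzkin_paths_Suc:
  "motzkin_paths (Suc m) = (#) 0 ` motzkin_paths m \<union>
     first_return ` (SIGMA k:{..<m}. motzkin_paths k \<times> motzkin_paths (m - 1 - k))"
proof (intro equalityI subsetI)
  fix h
  assume h: "h \<in> motzkin_paths (Suc m)"
  then obtain t where t: "h = 0 # t"
    by (cases h) (auto simp: motzkin_paths_def)
  show "h \<in> (#) 0 ` motzkin_paths m \<union>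
     first_return ` (SIGMA k:{..<m}. motzkin_paths k \<times> motzkin_paths (m - 1 - k))"
  proof (cases "hd t = 0")
    case True
    then show ?thesis
      using h Cons_0_motzkin_paths[of t m] t by blast
  next
    case False
    then show ?thesis
      using h motzkin_paths_first_return unfolding t by blast
  qed
next
  fix h
  assume "h \<in> (#) 0 ` motzkin_paths m \<union>
     first_return ` (SIGMA k:{..<m}. motzkin_paths k \<times> motzkin_paths (m - 1 - k))"
  then show "h \<in> motzkin_paths (Suc m)"
    using Cons_0_motzkin_paths first_return_motzkin_paths by blast
qed

text \<open>The second height tells the two kinds of path apart: 0 after a level step, 1 after an up
  step.\<close>

lemma Cons_0_first_return_disjoint:
  "(#) 0 ` motzkin_paths m \<inter> first_return ` (SIGMA k:K. motzkin_paths k \<times> motzkin_paths (f k)) = {}"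
proof -
  have "hd (map ((+) 1) a @ b) = 1" if "a \<in> motzkin_paths k" for a b k
    using that by (cases a) (auto simp: motzkin_paths_def)
  then show ?thesis
    by (fastforce simp: motzkin_paths_def first_return_def)
qed

text \<open>The decomposition by the first step and the first return mirrors the recursion of
  \<open>motzkin\<close>. Finiteness goes through the same induction because the cardinality of the
  union and of the \<open>SIGMA\<close> set relies on it.\<close>

lemma card_motzkin_paths: "finite (motzkin_paths m) \<and> card (motzkin_paths m) = motzkin m"
proof (induction m rule: less_induct)
  case (less m)
  show ?case
  proof (cases m)
    case 0
    then show ?thesis
      by (simp add: motzkin_paths_0)
  next
    case (Suc l)
    let ?S = "SIGMA k:{..<l}. motzkin_paths k \<times> motzkin_paths (l - 1 - k)"
    have IH: "finite (motzkin_paths k)" "card (motzkin_paths k) = motzkin k" if "k \<le> l" for k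
      using less that Suc by auto
    have fin: "finite ?S"
      using IH by (intro finite_SigmaI finite_cartesian_product) auto
    have "card ?S = (\<Sum>k<l. motzkin k * motzkin (l - 1 - k))"
      using IH by (subst card_SigmaI) (auto simp: card_cartesian_product intro!: sum.cong)
    moreover have "card (motzkin_paths m) = card ((#) 0 ` motzkin_paths l) + card (first_return ` ?S)"
      unfolding Suc motzkin_paths_Suc using IH fin
      by (intro card_Un_disjoint Cons_0_first_return_disjoint) auto
    ultimately have "card (motzkin_paths m) = motzkin m"
      using IH Suc by (simp add: card_image inj_on_first_return)
    then show ?thesis
      using IH fin by (simp add: Suc motzkin_paths_Suc)
  qed
qed

section \<open>Distance vectors are paths\<close>

text \<open>The sum of \<open>W\<close> and \<open>U\<close> stays inside \<open>U'\<close>, so by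
  the dimension formula intersecting with \<open>U\<close> costs at most one dimension.\<close>

lemma dim_Int_codim_1:
  fixes U U' W :: "('a::field ^ 'n) set"
  assumes "vec.subspace U" "vec.subspace W" "vec.subspace U'" "U \<subseteq> U'" "W \<subseteq> U'"
    and "vec.dim U' \<le> vec.dim U + 1"
  shows "vec.dim W \<le> vec.dim (W \<inter> U) + 1"
proof -
  have "{x + y |x y. x \<in> W \<and> y \<in> U} \<subseteq> U'"
    using assms vec.subspace_add by blast
  then have "vec.dim {x + y |x y. x \<in> W \<and> y \<in> U} \<le> vec.dim U'"
    by (rule vec.dim_subset)
  then show ?thesis
    using vec.dim_sums_Int[of W U] assms by linarith
qed

text \<open>Cutting \<open>U' \<inter> V'\<close> first by \<open>U\<close> and then by
  \<open>V\<close> loses at most one dimension each time. So the intersection grows by 0, 1 or 2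
  while the members grow by 1.\<close>

lemma injection_distance_step:
  fixes U U' V V' :: "('a::field ^ 'n) set"
  assumes "vec.subspace U" "vec.subspace U'" "vec.subspace V" "vec.subspace V'"
    and "U \<subseteq> U'" "V \<subseteq> V'"
    and "vec.dim U' = vec.dim U + 1" "vec.dim V' = vec.dim V + 1"
  shows "small_step (injection_distance U V) (injection_distance U' V')"
proof -
  have "vec.dim (U' \<inter> V') \<le> vec.dim (U' \<inter> V' \<inter> U) + 1"
    using assms by (intro dim_Int_codim_1[of _ _ U']) (auto intro: vec.subspace_inter)
  moreover have "vec.dim (U' \<inter> V' \<inter> U) \<le> vec.dim (U' \<inter> V' \<inter> U \<inter> V) + 1"
    using assms by (intro dim_Int_codim_1[of _ _ V']) (auto intro: vec.subspace_inter)
  moreover have "U' \<inter> V' \<inter> U \<inter> V = U \<inter> V"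
    using assms by blast
  moreover have "vec.dim (U \<inter> V) \<le> vec.dim (U' \<inter> V')"
    using assms by (intro vec.dim_subset) blast
  ultimately show ?thesis
    using assms by (simp add: injection_distance_def)
qed

lemma injection_distance_pos_iff:
  fixes U V :: "('a::field ^ 'n) set"
  assumes "vec.subspace U" "vec.subspace V" "vec.dim U = vec.dim V"
  shows "0 < injection_distance U V \<longleftrightarrow> U \<noteq> V"
proof
  assume "U \<noteq> V"
  have "vec.dim (U \<inter> V) \<noteq> vec.dim U"
  proof
    assume "vec.dim (U \<inter> V) = vec.dim U"
    then have "U \<inter> V = U" "U \<inter> V = V"
      using assms by (intro vec.subspace_dim_equal vec.subspace_inter; simp)+
    with \<open>U \<noteq> V\<close> show False
      by blast
  qed
  moreover have "vec.dim (U \<inter> V) \<le> vec.dim U"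
    by (intro vec.dim_subset) blast
  ultimately show "0 < injection_distance U V"
    by (simp add: injection_distance_def)
qed (auto simp: injection_distance_def)

lemma distance_vector_in_paths:
  fixes F F' :: "('a::field ^ 'n) set list"
  assumes F: "full_flag F" and F': "full_flag F'" and disj: "disjoint_flags F F'"
    and n: "CARD('n) = Suc (Suc m)"
  shows "distance_vector F F' \<in> map ((+) 1) ` motzkin_paths m"
proof -
  define D where "D = distance_vector F F'"
  have len: "length F = Suc m" "length F' = Suc m"
    using F F' n by (auto simp: full_flag_def)
  have lenD: "length D = Suc m"
    by (simp add: D_def distance_vector_def len)
  have D_nth: "D ! i = injection_distance (F ! i) (F' ! i)" if "i \<le> m" for i
    using that by (simp add: D_def distance_vector_def len)
  have sub: "vec.subspace (F ! i)" "vec.subspace (F' ! i)"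
    "vec.dim (F ! i) = i + 1" "vec.dim (F' ! i) = i + 1" if "i \<le> m" for i
    using that F F' len by (auto simp: full_flag_def)
  have mono: "F ! i \<subseteq> F ! Suc i" "F' ! i \<subseteq> F' ! Suc i" if "i < m" for i
  proof -
    have "sorted_wrt (\<subset>) F" "sorted_wrt (\<subset>) F'"
      using F F' by (auto simp: full_flag_def)
    then have "F ! i \<subset> F ! Suc i" "F' ! i \<subset> F' ! Suc i"
      using that by (simp_all add: sorted_wrt_nth_less len)
    then show "F ! i \<subseteq> F ! Suc i" "F' ! i \<subseteq> F' ! Suc i"
      by blast+
  qed
  have pos: "0 < D ! i" if "i \<le> m" for i
  proof -
    have "F ! i \<noteq> F' ! i"
      using disj that n by (simp add: disjoint_flags_def)
    then show ?thesis
      using injection_distance_pos_iff[of "F ! i" "F' ! i"] sub[OF that] D_nth[OF that] by simp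
  qed
  \<comment> \<open>Position 0 holds subspaces of dimension 1.\<close>
  have "D ! 0 \<le> 1"
    using sub[of 0] by (simp add: D_nth injection_distance_def)
  then have first: "D ! 0 = 1"
    using pos[of 0] by simp
  \<comment> \<open>Position \<open>m\<close> holds hyperplanes of the whole space, which has
    dimension \<open>m + 2\<close>.\<close>
  have "D ! m \<le> 1"
  proof -
    have "vec.dim (F ! m) \<le> vec.dim (F ! m \<inter> F' ! m) + 1"
      using sub[of m] n by (intro dim_Int_codim_1[of _ _ UNIV]) (auto simp: vec_dim_card simp del: vec.dim_UNIV)
    then show ?thesis
      by (simp add: D_nth injection_distance_def)
  qed
  then have final: "D ! m = 1"
    using pos[of m] by simp
  have step: "small_step (D ! i) (D ! Suc i)" if "i < m" for i
    using injection_distance_step[of "F ! i" "F ! Suc i" "F' ! i" "F' ! Suc i"]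
      sub[of i] sub[of "Suc i"] mono[OF that] that by (simp add: D_nth)
  have "D \<noteq> []"
    using lenD by auto
  then have "map (\<lambda>x. x - 1) D \<in> motzkin_paths m"
    using lenD first final pos step
    by (auto simp: motzkin_paths_def hd_map last_map hd_conv_nth last_conv_nth in_set_conv_nth
        successively_conv_nth less_Suc_eq_le)
  moreover have "D = map ((+) 1) (map (\<lambda>x. x - 1) D)"
    by (simp add: o_def)
  ultimately show ?thesis
    unfolding D_def by blast
qed

section \<open>Paths are distance vectors\<close>

text \<open>The span of the standard basis vectors indexed by \<open>S\<close>. Dimensions and
  intersections reduce to finite sets of indices, independently of the field.\<close>

definition coordinate_subspace :: "'n set \<Rightarrow> ('a::field ^ 'n) set" where
  "coordinate_subspace S = {v. \<forall>i. i \<notin> S \<longrightarrow> v $ i = 0}"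

lemma subspace_coordinate_subspace: "vec.subspace (coordinate_subspace S)"
  by (auto simp: coordinate_subspace_def vec.subspace_def)

lemma dim_coordinate_subspace: "vec.dim (coordinate_subspace S) = card S"
  unfolding coordinate_subspace_def by (rule dim_substandard_cart)

lemma coordinate_subspace_Int:
  "coordinate_subspace S \<inter> coordinate_subspace T = coordinate_subspace (S \<inter> T)"
  by (auto simp: coordinate_subspace_def)

lemma injection_distance_coordinate_subspace:
  "injection_distance (coordinate_subspace S :: ('a::field ^ 'n) set) (coordinate_subspace T)
     = int (card (S - T))"
  using card_Diff_subset_Int[of S T] card_mono[of S "S \<inter> T"]
  by (simp add: injection_distance_def coordinate_subspace_Int dim_coordinate_subspace of_nat_diff)

text \<open>An ordering of all coordinates yields a flag through its prefixes; strict inclusion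
  follows from the different dimensions.\<close>

lemma full_flag_coordinate_subspaces:
  fixes xs :: "'n::finite list"
  assumes "distinct xs" "length xs = CARD('n)"
  shows "full_flag (map (\<lambda>i. coordinate_subspace (set (take i xs)) :: ('a::field ^ 'n) set)
           [1..<CARD('n)])"
proof -
  have card: "card (set (take i xs)) = i" if "i \<le> CARD('n)" for i
    using that assms by (simp add: distinct_card)
  have "(coordinate_subspace (set (take i xs)) :: ('a ^ 'n) set) \<subset> coordinate_subspace (set (take j xs))"
    if "i < j" "j \<le> CARD('n)" for i j
  proof
    show "(coordinate_subspace (set (take i xs)) :: ('a ^ 'n) set)
        \<subseteq> coordinate_subspace (set (take j xs))"
      using set_take_subset_set_take[of i j xs] that by (auto simp: coordinate_subspace_def)
    show "(coordinate_subspace (set (take i xs)) :: ('a ^ 'n) set)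
        \<noteq> coordinate_subspace (set (take j xs))"
      using dim_coordinate_subspace[where 'a = 'a] card[of i] card[of j] that
      by (metis less_imp_le less_irrefl order_less_le_trans)
  qed
  then show ?thesis
    by (auto simp: full_flag_def sorted_wrt_iff_nth_less subspace_coordinate_subspace
        dim_coordinate_subspace card)
qed

text \<open>The two lists use \<open>m + d m\<close> coordinates altogether, so the hypothesis \<open>d i \<le> n - i\<close> guarantees
  that fresh coordinates are available.\<close>

lemma realise_path:
  fixes d :: "nat \<Rightarrow> int"
  assumes "d 0 = 0" and nonneg: "\<And>i. i \<le> CARD('n) \<Longrightarrow> 0 \<le> d i"
    and bound: "\<And>i. i \<le> CARD('n) \<Longrightarrow> d i \<le> int (CARD('n)) - int i"
    and step: "\<And>i. i < CARD('n) \<Longrightarrow> small_step (d i) (d (Suc i))"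
    and "m \<le> CARD('n)"
  shows "\<exists>xs ys :: 'n::finite list. distinct xs \<and> distinct ys \<and> length xs = m \<and> length ys = m \<and>
     (\<forall>i\<le>m. int (card (set (take i xs) - set (take i ys))) = d i)"
  using \<open>m \<le> CARD('n)\<close>
proof (induction m)
  case 0
  then show ?case
    using \<open>d 0 = 0\<close> by simp
next
  case (Suc m)
  then obtain xs ys :: "'n list" where xs: "distinct xs" "length xs = m"
    and ys: "distinct ys" "length ys = m"
    and dist: "\<And>i. i \<le> m \<Longrightarrow> int (card (set (take i xs) - set (take i ys))) = d i"
    by auto
  let ?X = "set xs" and ?Y = "set ys"
  have cX: "card ?X = m" and cY: "card ?Y = m"
    using xs ys by (auto simp: distinct_card)
  have cXY: "int (card (?X - ?Y)) = d m"
    using dist[of m] xs ys by simp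
  \<comment> \<open>Both sets have \<open>m\<close> elements, so their two differences have the same
    size.\<close>
  have cYX: "int (card (?Y - ?X)) = d m"
    using cXY cX cY card_Diff_subset_Int[of ?X ?Y] card_Diff_subset_Int[of ?Y ?X]
    by (simp add: Int_commute)
  have "card (?X \<union> ?Y) = card (?X - ?Y) + card ?Y"
    by (metis Un_Diff_cancel2 card_Un_disjoint Diff_disjoint Int_commute finite_set finite_Diff)
  then have cUn: "int (card (?X \<union> ?Y)) = int m + d m"
    using cXY cY by simp
  have fresh: "\<exists>z. z \<notin> A" if "card A < CARD('n)" for A :: "'n set"
    using that by (metis UNIV_eq_I less_irrefl)
  \<comment> \<open>Appending one coordinate to each list leaves all shorter prefixes unchanged, so
    only the new full lists have to be checked.\<close>
  have extend: ?case
    if "x \<notin> ?X" "y \<notin> ?Y" "int (card (insert x ?X - insert y ?Y)) = d (Suc m)" for x y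
  proof (intro exI conjI allI impI)
    fix i
    assume "i \<le> Suc m"
    then show "int (card (set (take i (xs @ [x])) - set (take i (ys @ [y])))) = d i"
      using that dist[of i] xs ys by (cases "i = Suc m") auto
  qed (use xs ys that in auto)
  have "small_step (d m) (d (Suc m))"
    using step Suc.prems by simp
  then consider "d (Suc m) = d m + 1" | "d (Suc m) = d m" | "d (Suc m) = d m - 1"
    by linarith
  then show ?case
  proof cases
    case 1
    \<comment> \<open>The bound at \<open>Suc m\<close>, applied after an up step, leaves room for
      two fresh coordinates rather than one.\<close>
    then have big: "int m + d m + 2 \<le> int (CARD('n))"
      using bound[of "Suc m"] Suc.prems by simp
    then obtain x where x: "x \<notin> ?X \<union> ?Y"
      using fresh[of "?X \<union> ?Y"] cUn by auto
    have "card (insert x (?X \<union> ?Y)) = Suc (card (?X \<union> ?Y))"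
      using x by simp
    then obtain y where y: "y \<notin> insert x (?X \<union> ?Y)"
      using fresh[of "insert x (?X \<union> ?Y)"] cUn big by auto
    have "insert x ?X - insert y ?Y = insert x (?X - ?Y)"
      using x y by auto
    then show ?thesis
      using x y 1 cXY by (intro extend[of x y]) auto
  next
    case 2
    then have "int m + d m + 1 \<le> int (CARD('n))"
      using bound[of "Suc m"] Suc.prems by simp
    then obtain x where x: "x \<notin> ?X \<union> ?Y"
      using fresh[of "?X \<union> ?Y"] cUn by auto
    have "insert x ?X - insert x ?Y = ?X - ?Y"
      using x by auto
    then show ?thesis
      using x 2 cXY by (intro extend[of x x]) auto
  next
    case 3
    then have pos: "0 < d m"
      using nonneg[of "Suc m"] Suc.prems by simp
    then have "?Y - ?X \<noteq> {}" "?X - ?Y \<noteq> {}"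
      using cXY cYX by (metis card.empty less_irrefl of_nat_0)+
    then obtain x y where xy: "x \<in> ?Y - ?X" "y \<in> ?X - ?Y"
      by blast
    \<comment> \<open>Since \<open>x\<close> already lies in \<open>?Y\<close>, it adds nothing to
      the difference, while \<open>y\<close> now drops out of it.\<close>
    have "insert x ?X - insert y ?Y = (?X - ?Y) - {y}"
      using xy by auto
    then have "int (card (insert x ?X - insert y ?Y)) = d (Suc m)"
      using xy 3 cXY pos by (simp add: card_Diff_singleton of_nat_diff)
    then show ?thesis
      using xy by (intro extend[of x y]) auto
  qed
qed

lemma path_in_distance_vectors:
  assumes h: "h \<in> motzkin_paths m" and n: "CARD('n::finite) = Suc (Suc m)"
  shows "\<exists>F F' :: ('a::field ^ 'n) set list. full_flag F \<and> full_flag F' \<and> disjoint_flags F F' \<and>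
           distance_vector F F' = map ((+) 1) h"
proof -
  \<comment> \<open>Here \<open>i\<close> is the dimension, so the height sits at position
    \<open>i - 1\<close>. Zeros are added for the zero subspace and for the whole space, of
    dimension \<open>m + 2\<close>.\<close>
  define d where "d i = (if i = 0 \<or> i = Suc (Suc m) then 0 else 1 + h ! (i - 1))" for i
  have h': "length h = Suc m" "h ! 0 = 0" "h ! m = 0"
    "\<And>i. i \<le> m \<Longrightarrow> 0 \<le> h ! i" "\<And>i. i < m \<Longrightarrow> small_step (h ! i) (h ! Suc i)"
    using h by (auto simp: motzkin_paths_def hd_conv_nth last_conv_nth successively_conv_nth
        less_Suc_eq_le simp flip: length_greater_0_conv)
  have pos: "1 \<le> d i" if "1 \<le> i" "i \<le> Suc m" for i
    using that h'(4)[of "i - 1"] by (simp add: d_def)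
  have nonneg: "0 \<le> d i" if "i \<le> CARD('n)" for i
    using that h'(4)[of "i - 1"] n by (auto simp: d_def)
  have small: "small_step (d i) (d (Suc i))" if i: "i < CARD('n)" for i
  proof -
    consider "i = 0" | "i = Suc m" | j where "i = Suc j" "j < m"
      using i n by (cases i) (auto simp: less_Suc_eq)
    then show ?thesis
      using h'(2,3,5) by cases (auto simp: d_def)
  qed
  \<comment> \<open>Downward induction from the end, where \<open>d\<close> is 0: each step back
    raises the value by at most 1.\<close>
  have bound: "d i \<le> int (CARD('n)) - int i" if "i \<le> CARD('n)" for i
    using that
  proof (induction i rule: inc_induct)
    case base
    then show ?case
      by (simp add: d_def n)
  next
    case (step i)
    then show ?case
      using small[of i] by simp
  qed
  obtain xs ys :: "'n list" where xs: "distinct xs" "length xs = CARD('n)"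
    and ys: "distinct ys" "length ys = CARD('n)"
    and dist: "\<And>i. i \<le> CARD('n) \<Longrightarrow> int (card (set (take i xs) - set (take i ys))) = d i"
    using realise_path[where 'n = 'n and d = d and m = "CARD('n)"] nonneg bound small
    by (auto simp: d_def)
  define F where "F = map (\<lambda>i. coordinate_subspace (set (take i xs)) :: ('a ^ 'n) set) [1..<CARD('n)]"
  define F' where "F' = map (\<lambda>i. coordinate_subspace (set (take i ys)) :: ('a ^ 'n) set) [1..<CARD('n)]"
  have flags: "full_flag F" "full_flag F'"
    unfolding F_def F'_def using xs ys by (intro full_flag_coordinate_subspaces; simp)+
  have nth: "injection_distance (F ! i) (F' ! i) = d (Suc i)" if "i \<le> m" for i
    using that n dist[of "Suc i"]
    by (simp add: F_def F'_def injection_distance_coordinate_subspace del: upt_Suc)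
  have "distance_vector F F' = map ((+) 1) h"
    using h'(1) n nth
    by (intro nth_equalityI) (auto simp: distance_vector_def F_def F'_def d_def simp del: upt_Suc)
  moreover have neq: "F ! i \<noteq> F' ! i" if "i \<le> m" for i
    using that nth[of i] pos[of "Suc i"] by (auto simp: injection_distance_def)
  \<comment> \<open>The members at position 0 already differ, which also gives
    \<open>F \<noteq> F'\<close>.\<close>
  have "disjoint_flags F F'"
    using neq neq[of 0] n by (auto simp: disjoint_flags_def)
  ultimately show ?thesis
    using flags by blast
qed

theorem corollary4p7:
  fixes q n :: nat
  assumes "primepow q" and "CARD('a::{field,finite}) = q"
    and "CARD('n::finite) = n" and "n \<ge> 2"
  shows "card {distance_vector F F' | (F :: ('a ^ 'n) set list) F'.
                 full_flag F \<and> full_flag F' \<and> disjoint_flags F F'} = elevated_motzkin n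
         \<and> elevated_motzkin n = motzkin (n - 2)"
proof -
  have n: "CARD('n) = Suc (Suc (n - 2))"
    using assms by simp
  have "{distance_vector F F' | (F :: ('a ^ 'n) set list) F'.
          full_flag F \<and> full_flag F' \<and> disjoint_flags F F'} = map ((+) 1) ` motzkin_paths (n - 2)"
  proof (intro equalityI subsetI)
    fix v
    assume "v \<in> map ((+) 1) ` motzkin_paths (n - 2)"
    then obtain h where "h \<in> motzkin_paths (n - 2)" "v = map ((+) 1) h"
      by blast
    then show "v \<in> {distance_vector F F' | (F :: ('a ^ 'n) set list) F'.
        full_flag F \<and> full_flag F' \<and> disjoint_flags F F'}"
      using path_in_distance_vectors[OF _ n, where 'a = 'a, of h] by force
  qed (use distance_vector_in_paths[OF _ _ _ n] in auto)
  \<comment> \<open>Raising all heights by 1 is injective, so the count of paths carries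
    over.\<close>
  moreover have "card (map ((+) (1::int)) ` motzkin_paths (n - 2)) = motzkin (n - 2)"
    using card_motzkin_paths by (subst card_image) (auto intro: inj_on_subset[OF inj_mapI])
  ultimately show ?thesis
    using assms by (simp add: elevated_motzkin_def)
qed

end
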